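(* Let $s\in\mathbb{N}$ and $n=2^s$. Then there are at least $2^{n/2}-1$ indecomposable solutions of size $n$, up to isomorphism.
   Context: $\mathbb{N}$ denotes the positive integers. A solution (set-theoretic, non-degenerate, involutive solution of the Yang-Baxter equation) is a triple $(X,\sigma,\tau)$ with $X$ a non-empty set and $\sigma,\tau\colon X^2\to X$ such that, writing $\sigma_x=\sigma(x,\cdot)$ and $\tau_y=\tau(\cdot,y)$, the map $r(x,y)=(\sigma_x(y),\tau_y(x))$ is a bijection of $X^2$ satisfying $(\mathrm{id}\times r)(r\times \mathrm{id})(\mathrm{id}\times r)=(r\times \mathrm{id})(\mathrm{id}\times r)(r\times \mathrm{id})$, all $\sigma_x,\tau_y$ are bijections, and $r^2=\mathrm{id}$. Its size is $|X|$. It is indecomposable if $\mathcal{G}(X)=\langle\sigma_x\mid x\in X\rangle$ acts transitively on $X$. An isomorphism $(X,\sigma,\tau)\to(X',\sigma',\tau')$ is a bijection $\Phi\colon X\to X'$ with $\Phi\sigma_x=\sigma'_{\Phi(x)}\Phi$ for all $x\in X$. *)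

theory Defs
  imports "HOL-Algebra.Group_Action" "HOL-Algebra.Generated_Groups"
begin

(* A triple (X, sigma, tau). Here sigma S x y and tau S x y stand for sigma(x,y) and tau(x,y);
   thus sigma_x is sigma S x, whereas tau_y, which acts on the first argument,
   is (\<lambda>x. tau S x y). Only the values on the carrier are meaningful. *)
record 'a ybe = "'a partial_object" +
  sigma :: "'a \<Rightarrow> 'a \<Rightarrow> 'a"
  tau :: "'a \<Rightarrow> 'a \<Rightarrow> 'a"

definition ybe_map :: "'a ybe \<Rightarrow> 'a \<times> 'a \<Rightarrow> 'a \<times> 'a" where
  "ybe_map S = (\<lambda>(x, y). (sigma S x y, tau S x y))"

(* r \<times> id and id \<times> r, both acting on triples (x, y, z) = (x, (y, z)). *)
definition times_id :: "('a \<times> 'a \<Rightarrow> 'a \<times> 'a) \<Rightarrow> 'a \<times> 'a \<times> 'a \<Rightarrow> 'a \<times> 'a \<times> 'a" where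
  "times_id r = (\<lambda>(x, y, z). (fst (r (x, y)), snd (r (x, y)), z))"

definition id_times :: "('a \<times> 'a \<Rightarrow> 'a \<times> 'a) \<Rightarrow> 'a \<times> 'a \<times> 'a \<Rightarrow> 'a \<times> 'a \<times> 'a" where
  "id_times r = (\<lambda>(x, y, z). (x, r (y, z)))"

definition ybe_solution :: "'a ybe \<Rightarrow> bool" where
  "ybe_solution S \<longleftrightarrow>
     (let X = carrier S; r = ybe_map S in
       X \<noteq> {} \<and>
       sigma S \<in> X \<rightarrow> X \<rightarrow> X \<and>
       tau S \<in> X \<rightarrow> X \<rightarrow> X \<and>
       bij_betw r (X \<times> X) (X \<times> X) \<and>
       (\<forall>t \<in> X \<times> X \<times> X.
          (id_times r \<circ> times_id r \<circ> id_times r) t = (times_id r \<circ> id_times r \<circ> times_id r) t) \<and>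
       (\<forall>x \<in> X. bij_betw (sigma S x) X X) \<and>
       (\<forall>y \<in> X. bij_betw (\<lambda>x. tau S x y) X X) \<and>
       (\<forall>p \<in> X \<times> X. r (r p) = p))"

(* The group G(X) generated by the sigma_x. Elements of BijGroup are extensional functions,
   hence the restriction to the carrier. *)
definition perm_group :: "'a ybe \<Rightarrow> ('a \<Rightarrow> 'a) monoid" where
  "perm_group S =
     subgroup_generated (BijGroup (carrier S)) ((\<lambda>x. restrict (sigma S x) (carrier S)) ` carrier S)"

definition indecomposable :: "'a ybe \<Rightarrow> bool" where
  "indecomposable S \<longleftrightarrow> transitive_action (perm_group S) (carrier S) (\<lambda>g. g)"

definition ybe_iso :: "'a ybe \<Rightarrow> 'b ybe \<Rightarrow> ('a \<Rightarrow> 'b) set" where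
  "ybe_iso S T = {\<Phi>. bij_betw \<Phi> (carrier S) (carrier T) \<and>
     (\<forall>x \<in> carrier S. \<forall>y \<in> carrier S. \<Phi> (sigma S x y) = sigma T (\<Phi> x) (\<Phi> y))}"

definition isomorphic :: "'a ybe \<Rightarrow> 'b ybe \<Rightarrow> bool" where
  "isomorphic S T \<longleftrightarrow> ybe_iso S T \<noteq> {}"

end

(* Put m = n/2 and let X be the integers modulo 2m, with sigma_x(y) = y + 1 + m F(x, y), where
   F(x, y) = h(x - y) + G(y) mod 2 depends only on x, y mod m. Any such h and G give a solution, a
   double cover of the solution sigma_x(y) = y + 1 on Z/m. A constant in h can be moved into G, and
   coboundaries in G do not matter up to isomorphism, so one may take h(0) = 0 and G supported on
   one residue class; this leaves 2^m pairs, and all but (0, 0) give indecomposable solutions. If h is not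
   constant, the covering X -> Z/m can be recovered from the solution, because the elements
   sigma_x(y) with y fixed fill a whole fibre. An isomorphism Phi then has the form
   Phi(y) = y + t + m u(y), and h(d) - h'(d) = u(y) - u(y+1) - G(y) + G'(y+t) mod 2. Here d = 0
   gives h = h', and summing over y in Z/m gives the equality of the total masses of G and G'. *)
theory Submission
  imports Defs "HOL-Number_Theory.Cong"
begin

section \<open>Transitivity of the permutation group from reachability\<close>

text \<open>Composing the generators along a path from x to y gives a single group element carrying
  x to y, so transitivity reduces to walking with the maps \<open>sigma S z\<close>.\<close>

lemma indecomposable_if_reachable:
  assumes S: "ybe_solution S"
    and reach: "\<And>x y. x \<in> carrier S \<Longrightarrow> y \<in> carrier S \<Longrightarrow>
      (x, y) \<in> {(u, sigma S z u) |z u. z \<in> carrier S \<and> u \<in> carrier S}\<^sup>*"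
  shows "indecomposable S"
proof -
  define X where "X = carrier S"
  define A where "A = (\<lambda>x. restrict (sigma S x) X) ` X"
  have maps: "sigma S x y \<in> X" if "x \<in> X" "y \<in> X" for x y
    using S that unfolding ybe_solution_def X_def Let_def by blast
  have bij: "bij_betw (sigma S x) X X" if "x \<in> X" for x
    using S that unfolding ybe_solution_def X_def Let_def by blast
  interpret B: group "BijGroup X" by (rule group_BijGroup)
  have A: "A \<subseteq> carrier (BijGroup X)"
    using bij by (auto simp: A_def BijGroup_def Bij_def)
  have P: "perm_group S = subgroup_generated (BijGroup X) A"
    by (simp add: perm_group_def A_def X_def)
  have carrier_P: "carrier (perm_group S) = generate (BijGroup X) A"
    using A by (simp add: P carrier_subgroup_generated inf_absorb2)
  have incl: "generate (BijGroup X) A \<subseteq> Bij X"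
    using B.generate_incl[OF A] by (simp add: BijGroup_def)
  have "group_hom (perm_group S) (BijGroup X) (\<lambda>g. g)"
  proof (rule group_hom.intro)
    show "group (perm_group S)" unfolding P by simp
    show "group (BijGroup X)" by (rule group_BijGroup)
    show "group_hom_axioms (perm_group S) (BijGroup X) (\<lambda>g. g)"
      using B.generate_incl[OF A]
      by (auto simp: group_hom_axioms_def hom_def carrier_P) (simp add: P)
  qed
  moreover have "\<exists>g \<in> carrier (perm_group S). g x = y" if "x \<in> X" "y \<in> X" for x y
    using reach[unfolded X_def[symmetric], OF that]
  proof (induction rule: rtrancl_induct)
    case base
    have "\<one>\<^bsub>BijGroup X\<^esub> \<in> carrier (perm_group S)"
      by (simp add: carrier_P generate.one)
    then show ?case using that by (intro bexI) (auto simp: BijGroup_def)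
  next
    case (step u v)
    then obtain z g where z: "z \<in> X" "u \<in> X" "v = sigma S z u"
      and g: "g \<in> carrier (perm_group S)" "g x = u" by auto
    define s where "s = restrict (sigma S z) X"
    have s: "s \<in> generate (BijGroup X) A"
      using z by (auto simp: s_def A_def intro: generate.incl)
    then have "s \<otimes>\<^bsub>BijGroup X\<^esub> g \<in> carrier (perm_group S)"
      using g by (auto simp: carrier_P intro: generate.eng)
    moreover have "(s \<otimes>\<^bsub>BijGroup X\<^esub> g) x = v"
      using s g z incl that by (auto simp: carrier_P BijGroup_def s_def compose_def)
    ultimately show ?case by blast
  qed
  ultimately show ?thesis
    unfolding indecomposable_def X_def[symmetric]
    by (auto simp: transitive_action_def group_action_def transitive_action_axioms_def)
qed

section \<open>Solutions on the integers modulo \<open>N\<close> built from a cocycle\<close>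

text \<open>\<open>cocycle\<close> says that the diagonal increment of \<open>F\<close> depends on
  the second argument only; each coordinate of the braid relation reduces to an instance of
  it.\<close>

locale cyclic_cocycle =
  fixes N m :: nat and F :: "int \<Rightarrow> int \<Rightarrow> int"
  assumes N_pos: "N > 0" and m_dvd_N: "m dvd N"
    and F_cong: "\<And>x x' y y'. [x = x'] (mod int m) \<Longrightarrow> [y = y'] (mod int m) \<Longrightarrow> F x y = F x' y'"
    and cocycle: "\<And>x y z. F (x + 1) (z + 1) - F x z = F (y + 1) (z + 1) - F y z"
begin

text \<open>It is convenient to compute with arbitrary integers: elements of the carrier are written
  \<open>elt x\<close>, and the braid relations below hold exactly over the integers.\<close>

definition elt :: "int \<Rightarrow> nat" where
  "elt z = nat (z mod int N)"

definition left_map :: "int \<Rightarrow> int \<Rightarrow> int" where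
  "left_map x y = y + 1 + int m * F x y"

text \<open>Involutivity forces this formula: it is the preimage of x under
  \<open>left_map (left_map x y)\<close>, where \<open>F\<close> sees only the residues of y + 1 and
  x - 1.\<close>

definition right_map :: "int \<Rightarrow> int \<Rightarrow> int" where
  "right_map x y = x - 1 - int m * F (y + 1) (x - 1)"

definition solution :: "nat ybe" where
  "solution = \<lparr>carrier = {..<N}, sigma = (\<lambda>x y. elt (left_map (int x) (int y))),
     tau = (\<lambda>x y. elt (right_map (int x) (int y)))\<rparr>"

lemma int_elt: "int (elt z) = z mod int N"
  using N_pos by (simp add: elt_def)

lemma elt_int: "x < N \<Longrightarrow> elt (int x) = x"
  by (simp add: elt_def flip: zmod_int)

lemma elt_less: "elt z < N"
  using N_pos by (simp add: elt_def nat_less_iff)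

lemma elt_eq_iff: "elt x = elt y \<longleftrightarrow> [x = y] (mod int N)"
  by (metis int_elt cong_def of_nat_eq_iff)

lemma carrier_solution: "carrier solution = range elt"
  using elt_int elt_less by (auto simp: solution_def) (metis rangeI)

lemma carrier_cases:
  assumes "x \<in> carrier solution" obtains x' where "x = elt x'"
  using assms by (auto simp: carrier_solution)

lemma elt_in_carrier [simp]: "elt x \<in> carrier solution"
  by (simp add: carrier_solution)

lemma cong_N_m: "[x = y] (mod int N) \<Longrightarrow> [x = y] (mod int m)"
  using m_dvd_N cong_dvd_modulus by (meson int_dvd_int_iff)

lemma int_elt_cong: "[int (elt x) = x] (mod int N)"
  by (simp add: int_elt cong_def)

lemma F_elt: "F (int (elt x)) y = F x y" "F x (int (elt y)) = F x y"
  by (auto intro!: F_cong cong_N_m int_elt_cong)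

lemma sigma_elt [simp]: "sigma solution (elt x) (elt y) = elt (left_map x y)"
  by (auto simp: solution_def left_map_def elt_eq_iff F_elt intro!: cong_add int_elt_cong)

lemma tau_elt [simp]: "tau solution (elt x) (elt y) = elt (right_map x y)"
proof -
  have "F (int (elt y) + 1) (int (elt x) - 1) = F (y + 1) (x - 1)"
    by (intro F_cong cong_add cong_diff cong_refl cong_N_m int_elt_cong)
  then show ?thesis
    by (auto simp: solution_def right_map_def elt_eq_iff intro!: cong_diff int_elt_cong)
qed

lemma left_map_cong: "[left_map x y = y + 1] (mod int m)"
  by (simp add: left_map_def cong_iff_dvd_diff)

lemma right_map_cong: "[right_map x y = x - 1] (mod int m)"
  by (simp add: right_map_def cong_iff_dvd_diff)

lemma left_map_right_map [simp]: "left_map (left_map x y) (right_map x y) = x"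
proof -
  have "F (left_map x y) (right_map x y) = F (y + 1) (x - 1)"
    by (intro F_cong left_map_cong right_map_cong)
  then show ?thesis by (simp add: left_map_def right_map_def)
qed

lemma right_map_left_map [simp]: "right_map (left_map x y) (right_map x y) = y"
proof -
  have "F (right_map x y + 1) (left_map x y - 1) = F x y"
    using cong_add[OF right_map_cong cong_refl[of 1]] cong_diff[OF left_map_cong cong_refl[of 1]]
    by (intro F_cong) (metis diff_add_cancel, metis add_diff_cancel_right')
  then show ?thesis unfolding right_map_def[of "left_map x y"] by (simp add: left_map_def)
qed

lemma F_simps:
  "F (x + int m * a) y = F x y" "F x (y + int m * a) = F x y"
  "F (x - int m * a) y = F x y" "F x (y - int m * a) = F x y"
  by (auto intro!: F_cong simp: cong_iff_dvd_diff)

text \<open>Inside nested maps the arguments of \<open>F\<close> matter only modulo m, where every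
  map is a shift by one. The braid relations thus become linear identities in values of
  \<open>F\<close>.\<close>

lemma left_map_eq: "[x = x'] (mod int m) \<Longrightarrow> [y = y'] (mod int m) \<Longrightarrow> left_map x y = y + 1 + int m * F x' y'"
  using F_cong[of x x' y y'] by (simp add: left_map_def)

lemma right_map_eq: "[x = x'] (mod int m) \<Longrightarrow> [y = y'] (mod int m) \<Longrightarrow>
    right_map x y = x - 1 - int m * F (y' + 1) (x' - 1)"
  using F_cong[of "y + 1" "y' + 1" "x - 1" "x' - 1"]
  by (simp add: right_map_def cong_add_rcancel cong_diff)

text \<open>First coordinate of the braid relation; \<open>braid2\<close> and \<open>braid3\<close>
  give the other two. Both sides are z + 2 plus m times a sum of two values of \<open>F\<close>, and
  the sums agree by \<open>cocycle\<close>.\<close>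

lemma braid1: "left_map x (left_map y z) = left_map (left_map x y) (left_map (right_map x y) z)"
proof -
  have "left_map x (left_map y z) = left_map y z + 1 + int m * F x (z + 1)"
    by (intro left_map_eq left_map_cong cong_refl)
  moreover have "left_map (left_map x y) (left_map (right_map x y) z)
      = left_map (right_map x y) z + 1 + int m * F (y + 1) (z + 1)"
    by (intro left_map_eq left_map_cong)
  moreover have "left_map (right_map x y) z = z + 1 + int m * F (x - 1) z"
    by (intro left_map_eq right_map_cong cong_refl)
  moreover have "int m * F x (z + 1) + int m * F y z
      = int m * F (y + 1) (z + 1) + int m * F (x - 1) z"
    using cocycle[of "x - 1" z y] by (simp flip: distrib_left)
  ultimately show ?thesis using left_map_def[of y z] by linarith
qed

lemma braid3: "right_map (right_map x y) z = right_map (right_map x (left_map y z)) (right_map y z)"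
proof -
  have "right_map (right_map x y) z = right_map x y - 1 - int m * F (z + 1) (x - 1 - 1)"
    by (intro right_map_eq right_map_cong cong_refl)
  moreover have "right_map (right_map x (left_map y z)) (right_map y z)
      = right_map x (left_map y z) - 1 - int m * F (y - 1 + 1) (x - 1 - 1)"
    by (intro right_map_eq right_map_cong)
  moreover have "right_map x (left_map y z) = x - 1 - int m * F (z + 1 + 1) (x - 1)"
    by (intro right_map_eq left_map_cong cong_refl)
  moreover have "int m * F (z + 1) (x - 1 - 1) + int m * F (y + 1) (x - 1)
      = int m * F (y - 1 + 1) (x - 1 - 1) + int m * F (z + 1 + 1) (x - 1)"
    using cocycle[of "z + 1" "x - 1 - 1" y] by (simp flip: distrib_left)
  ultimately show ?thesis using right_map_def[of x y] by linarith
qed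

lemma braid2: "left_map (right_map x (left_map y z)) (right_map y z)
    = right_map (left_map x y) (left_map (right_map x y) z)"
proof -
  have "left_map (right_map x (left_map y z)) (right_map y z)
      = right_map y z + 1 + int m * F (x - 1) (y - 1)"
    by (intro left_map_eq right_map_cong)
  moreover have "right_map (left_map x y) (left_map (right_map x y) z)
      = left_map x y - 1 - int m * F (z + 1 + 1) (y + 1 - 1)"
    by (intro right_map_eq left_map_cong)
  moreover have "int m * F (x - 1) (y - 1) + int m * F (z + 1 + 1) (y + 1 - 1)
      = int m * F x y + int m * F (z + 1) (y - 1)"
    using cocycle[of "x - 1" "y - 1" "z + 1"] by (simp flip: distrib_left)
  ultimately show ?thesis using right_map_def[of y z] left_map_def[of x y] by linarith
qed

lemma ybe_solution_solution: "ybe_solution solution"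
proof -
  let ?X = "carrier solution" and ?r = "ybe_map solution"
  have fin: "finite ?X" by (simp add: solution_def)
  have r_elt: "?r (elt x, elt y) = (elt (left_map x y), elt (right_map x y))" for x y
    by (simp add: ybe_map_def)
  have invol: "?r (?r p) = p" if "p \<in> ?X \<times> ?X" for p
    using that by (auto simp: r_elt carrier_solution)
  have r_in: "?r p \<in> ?X \<times> ?X" if "p \<in> ?X \<times> ?X" for p
    using that by (auto simp: r_elt carrier_solution)
  have bij_r: "bij_betw ?r (?X \<times> ?X) (?X \<times> ?X)"
    by (rule bij_betw_byWitness[where f' = ?r]) (use invol r_in in blast)+
  have braid: "(id_times ?r \<circ> times_id ?r \<circ> id_times ?r) t = (times_id ?r \<circ> id_times ?r \<circ> times_id ?r) t"
    if "t \<in> ?X \<times> ?X \<times> ?X" for t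
  proof -
    obtain x y z where t: "t = (elt x, elt y, elt z)"
      using \<open>t \<in> _\<close> by (auto elim!: carrier_cases)
    show ?thesis
      unfolding t by (simp add: id_times_def times_id_def r_elt braid2 braid1[of x y z] braid3[of x y z])
  qed
  \<comment> \<open>The carrier is finite, so it suffices to exhibit preimages.\<close>
  have surj_bij: "bij_betw f ?X ?X" if "\<And>z. f (elt z) \<in> ?X" "\<And>z. \<exists>y. f (elt y) = elt z" for f
  proof -
    have "f ` ?X = ?X"
      using that by (auto simp: carrier_solution image_iff) (metis rangeI)+
    then show ?thesis by (simp add: bij_betw_def finite_surj_inj fin)
  qed
  have bij_sigma: "bij_betw (sigma solution (elt x)) ?X ?X" for x
  proof (rule surj_bij)
    fix z
    have "left_map x (z - 1 - int m * F x (z - 1)) = z"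
      by (simp add: left_map_def F_simps)
    then show "\<exists>y. sigma solution (elt x) (elt y) = elt z" by (metis sigma_elt)
  qed simp
  have bij_tau: "bij_betw (\<lambda>x. tau solution x (elt y)) ?X ?X" for y
  proof (rule surj_bij)
    fix z
    have "right_map (z + 1 + int m * F (y + 1) z) y = z"
      using F_simps(2)[of "y + 1" z "F (y + 1) z"] by (simp add: right_map_def add_diff_eq diff_add_eq)
    then show "\<exists>x. tau solution (elt x) (elt y) = elt z" by (metis tau_elt)
  qed simp
  show ?thesis
    unfolding ybe_solution_def Let_def
    using invol bij_r braid bij_sigma bij_tau by (auto simp: carrier_solution)
qed

text \<open>At every y some \<open>left_map x\<close> acts as y + 1 modulo \<open>N\<close>, and
  unit steps reach the whole cycle.\<close>

lemma indecomposable_solution: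
  assumes F: "\<And>y. \<exists>x. [int m * F x y = 0] (mod int N)"
  shows "indecomposable solution"
proof (rule indecomposable_if_reachable[OF ybe_solution_solution])
  fix x y
  assume "x \<in> carrier solution" "y \<in> carrier solution"
  then obtain a b where ab: "x = elt a" "y = elt b" by (auto elim!: carrier_cases)
  let ?R = "{(u, sigma solution z u) |z u. z \<in> carrier solution \<and> u \<in> carrier solution}"
  have succ: "(elt u, elt (u + 1)) \<in> ?R" for u
  proof -
    obtain z where "[int m * F z u = 0] (mod int N)" using F by blast
    then have "[left_map z u = u + 1] (mod int N)"
      using cong_add[OF cong_refl[of "u + 1"], of "int m * F z u" 0] by (simp add: left_map_def)
    then have "sigma solution (elt z) (elt u) = elt (u + 1)" by (simp add: elt_eq_iff)
    then show ?thesis by (smt (verit) elt_in_carrier mem_Collect_eq)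
  qed
  have "(elt a, elt (a + int k)) \<in> ?R\<^sup>*" for k
  proof (induction k)
    case (Suc k)
    moreover have "(elt (a + int k), elt (a + int (Suc k))) \<in> ?R"
      using succ[of "a + int k"] by (simp only: of_nat_Suc ac_simps)
    ultimately show ?case by (rule rtrancl_into_rtrancl)
  qed simp
  \<comment> \<open>The number of unit steps from a to b, as a nonnegative residue.\<close>
  from this[of "nat ((b - a) mod int N)"] show "(x, y) \<in> ?R\<^sup>*"
    using N_pos by (simp add: ab elt_def mod_add_right_eq)
qed

end

section \<open>The double covers indexed by subsets\<close>

text \<open>A set \<open>H \<subseteq> {..<m}\<close> encodes the pair \<open>(h, G)\<close>: its nonzero elements are the support of \<open>h\<close>,
  while \<open>0 \<in> H\<close> means \<open>G = 0\<close>, so that the decomposable case corresponds to \<open>H = {}\<close>.\<close>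

definition shape :: "nat \<Rightarrow> nat set \<Rightarrow> int \<Rightarrow> int" where
  "shape m H d = of_bool (nat (d mod int m) \<in> H - {0})"

definition defect :: "nat \<Rightarrow> nat set \<Rightarrow> int \<Rightarrow> int" where
  "defect m H y = of_bool (0 \<notin> H \<and> int m dvd y)"

definition shape_cocycle :: "nat \<Rightarrow> nat set \<Rightarrow> int \<Rightarrow> int \<Rightarrow> int" where
  "shape_cocycle m H x y = shape m H (x - y) + defect m H y"

lemma shape_0 [simp]: "shape m H 0 = 0"
  by (simp add: shape_def)

lemma shape_cong: "[d = d'] (mod int m) \<Longrightarrow> shape m H d = shape m H d'"
  by (simp add: shape_def cong_def)

lemma defect_cong: "[y = y'] (mod int m) \<Longrightarrow> defect m H y = defect m H y'"
  by (simp add: defect_def cong_dvd_iff)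

lemma shape_cocycle_cong: "[x = x'] (mod int m) \<Longrightarrow> [y = y'] (mod int m) \<Longrightarrow>
    shape_cocycle m H x y = shape_cocycle m H x' y'"
  unfolding shape_cocycle_def by (intro arg_cong2[where f = "(+)"] shape_cong defect_cong cong_diff)

text \<open>Shifting both arguments by one keeps x - y, so the increment of
  \<open>shape_cocycle\<close> is that of \<open>defect\<close>, which does not involve x.\<close>

lemma cyclic_cocycle_shape: "m > 0 \<Longrightarrow> cyclic_cocycle (2 * m) m (shape_cocycle m H)"
  by unfold_locales (auto intro: shape_cocycle_cong, simp add: shape_cocycle_def)

lemma shape_nat: "j < m \<Longrightarrow> shape m H (int j) = of_bool (j \<in> H - {0})"
  by (simp add: shape_def)

text \<open>A nonzero j in \<open>H\<close> gives h(j) = 1 against h(0) = 0, so x = y and x = y + j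
  yield opposite parities.\<close>

lemma shape_cocycle_parity:
  assumes "H \<subseteq> {..<m}" "H \<noteq> {}" "H \<noteq> {0}"
  shows "\<exists>x. even (shape_cocycle m H x y) = b"
proof -
  have "\<not> H \<subseteq> {0}" using assms by (simp add: subset_singleton_iff)
  then obtain j where j: "j \<in> H" "j \<noteq> 0" "j < m" using assms(1) by auto
  have "shape_cocycle m H (y + int j) y = 1 + shape_cocycle m H y y"
    using j by (simp add: shape_cocycle_def shape_nat)
  then have "even (shape_cocycle m H (y + int j) y) \<longleftrightarrow> odd (shape_cocycle m H y y)" by simp
  then show ?thesis by (cases b; cases "even (shape_cocycle m H y y)") (simp; blast)+
qed

text \<open>The multiples of m modulo 2m form a copy of Z/2, which turns congruences within a fibre
  into parity statements.\<close>

lemma cong_double_mult_iff: "m > 0 \<Longrightarrow> [int m * a = int m * b] (mod 2 * int m) \<longleftrightarrow> even (a - b)"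
  using dvd_times_left_cancel_iff[of "int m" 2 "a - b"]
  by (simp add: cong_iff_dvd_diff right_diff_distrib mult.commute[of 2 "int m"])

section \<open>Rigidity: recovering the subset from the isomorphism class\<close>

text \<open>Over one period the increments of \<open>u\<close> sum to an even number, yet exactly
  one of them, at the residue of -c, is odd.\<close>

lemma no_parity_defect:
  fixes u :: "int \<Rightarrow> int"
  assumes "m > 0"
    and period: "\<And>y. even (u (y + int m) - u y)"
    and step: "\<And>y. even (u (y + 1) - u y + of_bool (int m dvd y + c))"
  shows False
proof -
  \<comment> \<open>Starting just after -c, the next m - 1 steps avoid the exceptional residue, so
    the parity of \<open>u\<close> is kept up to -c + m.\<close>
  have "even (u (- c + 1 + int k) - u (- c + 1))" if "k < m" for k
    using that
  proof (induction k)
    case (Suc k)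
    have "\<not> int m dvd int (Suc k)" using Suc.prems by (simp only: int_dvd_int_iff) (auto dest: dvd_imp_le)
    then have "even (u (- c + 1 + int k + 1) - u (- c + 1 + int k))"
      using step[of "- c + 1 + int k"] by (simp add: algebra_simps)
    then show ?case using Suc by (simp add: algebra_simps)
  qed simp
  from this[of "m - 1"] have "even (u (- c + int m) - u (- c + 1))"
    using \<open>m > 0\<close> by (simp add: of_nat_diff)
  moreover have "odd (u (- c + 1) - u (- c))" using step[of "- c"] by simp
  ultimately show False using period[of "- c"] by presburger
qed

text \<open>Here \<open>\<phi>\<close> is an isomorphism lifted to the integers, so that all
  arguments can be carried out with congruences modulo 2m.\<close>

lemma shape_rigid:
  fixes \<phi> :: "int \<Rightarrow> int"
  assumes "m > 0"
    and H: "H \<subseteq> {..<m}" "H \<noteq> {}" and K: "K \<subseteq> {..<m}" "K \<noteq> {}"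
    and hom: "\<And>x y. [\<phi> (y + 1 + int m * shape_cocycle m H x y)
      = \<phi> y + 1 + int m * shape_cocycle m K (\<phi> x) (\<phi> y)] (mod 2 * int m)"
    and inj: "\<And>x y. [\<phi> x = \<phi> y] (mod 2 * int m) \<longleftrightarrow> [x = y] (mod 2 * int m)"
    and surj: "\<And>w. \<exists>x. [\<phi> x = w] (mod 2 * int m)"
  shows "H = K"
proof -
  have cong_m: "[x = y] (mod int m)" if "[x = y] (mod 2 * int m)" for x y :: int
    using that cong_dvd_modulus by (metis dvd_triv_right)
  have shape_eqD: "H - {0} = K - {0}" if "\<And>d. even (shape m H d - shape m K d)"
  proof -
    have "j \<in> H - {0} \<longleftrightarrow> j \<in> K - {0}" if "j < m" for j
      using \<open>\<And>d. even (shape m H d - shape m K d)\<close>[of "int j"] that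
      by (auto simp: shape_nat split: if_splits)
    then show ?thesis using H(1) K(1) by (auto simp: subset_iff)
  qed
  show ?thesis
  \<comment> \<open>For H = {0} the cocycle vanishes and the fibre argument of the other case does
    not apply. Instead, sigma_x does not depend on x; this passes to \<open>K\<close> and forces its
    shape to vanish.\<close>
  proof (cases "H = {0}")
    case True
    then have F0: "shape_cocycle m H x y = 0" for x y
      by (simp add: shape_cocycle_def shape_def defect_def)
    have const: "[\<phi> (0 + 1 + int m * 0) = \<phi> 0 + 1 + int m * shape_cocycle m K (\<phi> x) (\<phi> 0)] (mod 2 * int m)" for x
      using hom[of 0 x] by (simp only: F0)
    have "even (shape m H d - shape m K d)" for d
    proof -
      obtain x where x: "[\<phi> x = \<phi> 0 + d] (mod 2 * int m)" using surj by blast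
      have "[\<phi> 0 + 1 + int m * shape_cocycle m K (\<phi> x) (\<phi> 0)
          = \<phi> 0 + 1 + int m * shape_cocycle m K (\<phi> 0) (\<phi> 0)] (mod 2 * int m)"
        by (rule cong_trans[OF cong_sym[OF const] const])
      then have "even (shape_cocycle m K (\<phi> x) (\<phi> 0) - shape_cocycle m K (\<phi> 0) (\<phi> 0))"
        using \<open>m > 0\<close> by (simp only: cong_add_lcancel cong_double_mult_iff)
      moreover have "shape_cocycle m K (\<phi> x) (\<phi> 0) = shape_cocycle m K (\<phi> 0 + d) (\<phi> 0)"
        using x by (intro shape_cocycle_cong cong_m cong_refl)
      moreover have "shape m H d = 0" using True by (simp add: shape_def)
      ultimately show ?thesis by (simp add: shape_cocycle_def)
    qed
    from shape_eqD[OF this] have "K \<subseteq> {0}" using True by simp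
    then show ?thesis using True K(2) by (simp add: subset_singleton_iff)
  next
    case False
    have parity_cong: "[\<phi> (w + int m * a) = \<phi> (w + int m * b)] (mod 2 * int m)" if "even (a - b)" for w a b
      using that \<open>m > 0\<close> by (simp only: inj cong_add_lcancel cong_double_mult_iff)
    \<comment> \<open>As a varies, y + 1 + m a runs through a whole fibre. Some x of matching parity
      makes it sigma_x(y), whose image lies over \<open>\<phi> y + 1\<close>.\<close>
    have residue: "[\<phi> (y + 1 + int m * a) = \<phi> y + 1] (mod int m)" for y a
    proof -
      obtain x where "even (shape_cocycle m H x y) = even a"
        using shape_cocycle_parity[OF H False] by blast
      then have "even (a - shape_cocycle m H x y)" by simp
      then have "[\<phi> (y + 1 + int m * a) = \<phi> y + 1 + int m * shape_cocycle m K (\<phi> x) (\<phi> y)] (mod 2 * int m)"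
        using parity_cong hom cong_trans by blast
      then have "[\<phi> (y + 1 + int m * a) = \<phi> y + 1 + int m * shape_cocycle m K (\<phi> x) (\<phi> y)] (mod int m)"
        by (rule cong_m)
      then show ?thesis by (simp add: cong_def)
    qed
    define t where "t = \<phi> 0"
    \<comment> \<open>By \<open>residue\<close>, \<open>\<phi>\<close> commutes with adding one
      modulo m; induction runs in both directions from 0.\<close>
    have translation: "[\<phi> y = y + t] (mod int m)" for y
    proof (induction y rule: int_induct[where k = 0])
      case (step1 i)
      have "[\<phi> i + 1 = i + t + 1] (mod int m)" using step1 by (simp only: cong_add_rcancel)
      with residue[of i 0] show ?case by (simp add: cong_def algebra_simps)
    next
      case (step2 i)
      then have "[\<phi> (i - 1) + 1 = i - 1 + t + 1] (mod int m)"
        using residue[of "i - 1" 0] by (simp add: cong_def algebra_simps)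
      then show ?case by (simp only: cong_add_rcancel)
    qed (simp add: t_def)
    \<comment> \<open>The fibre coordinate of \<open>\<phi>\<close>; the division is exact by
      \<open>translation\<close>.\<close>
    define u where "u y = (\<phi> y - y - t) div int m" for y
    have \<phi>_eq: "\<phi> y = y + t + int m * u y" for y
    proof -
      have "int m dvd \<phi> y - (y + t)" using translation cong_iff_dvd_diff by blast
      then show ?thesis by (simp add: u_def diff_diff_eq)
    qed
    have u_cong: "even (u x - u y)" if "[x = y] (mod 2 * int m)" for x y
    proof -
      have "[x + t + int m * u x = y + t + int m * u y] (mod 2 * int m)"
        using inj that by (simp flip: \<phi>_eq)
      moreover have "[y + t + int m * u y = x + t + int m * u y] (mod 2 * int m)"
        using that by (intro cong_add cong_refl) (rule cong_sym)
      ultimately have "[x + t + int m * u x = x + t + int m * u y] (mod 2 * int m)"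
        by (rule cong_trans)
      then show ?thesis using \<open>m > 0\<close> by (simp only: cong_add_lcancel cong_double_mult_iff)
    qed
    \<comment> \<open>A change of parity would offset the shift by m, and \<open>\<phi>\<close>
      would identify the two points of a fibre.\<close>
    have u_period: "even (u (y + int m) - u y)" for y
    proof (rule ccontr)
      assume "odd (u (y + int m) - u y)"
      then have "even (1 + u (y + int m) - u y)" by simp
      then have "[int m * (1 + u (y + int m)) = int m * u y] (mod 2 * int m)"
        using \<open>m > 0\<close> by (simp only: cong_double_mult_iff)
      then have "[y + t + int m * (1 + u (y + int m)) = y + t + int m * u y] (mod 2 * int m)"
        by (simp only: cong_add_lcancel)
      then have "[\<phi> (y + int m) = \<phi> y] (mod 2 * int m)"
        by (simp only: \<phi>_eq) (simp add: algebra_simps)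
      then have "[y + int m * 1 = y + int m * 0] (mod 2 * int m)" by (simp add: inj)
      then show False using \<open>m > 0\<close> by (simp only: cong_add_lcancel cong_double_mult_iff) simp
    qed
    have u_mult: "even (u (y + int m * a) - u y)" for y a
    proof (cases "even a")
      case True
      then have "[y + int m * a = y + int m * 0] (mod 2 * int m)"
        using \<open>m > 0\<close> by (simp only: cong_add_lcancel cong_double_mult_iff) simp
      then show ?thesis using u_cong by simp
    next
      case False
      then have "[y + int m * a = y + int m * 1] (mod 2 * int m)"
        using \<open>m > 0\<close> by (simp only: cong_add_lcancel cong_double_mult_iff) simp
      then have "even (u (y + int m * a) - u (y + int m))" using u_cong by simp
      then show ?thesis using u_period[of y] by presburger
    qed
    \<comment> \<open>The homomorphism condition at x = y + d, after cancelling y + t + 1 and the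
      factor m. \<open>u_mult\<close> removes the multiple of m from the argument of
      \<open>u\<close>.\<close>
    have main: "even (u (y + 1) - u y + shape m H d - shape m K d + defect m H y - defect m K (y + t))" for y d
    proof -
      let ?f = "shape_cocycle m H (y + d) y" and ?g = "shape_cocycle m K (y + d + t) (y + t)"
      have g: "shape_cocycle m K (\<phi> (y + d)) (\<phi> y) = ?g"
        by (intro shape_cocycle_cong translation)
      have "[y + 1 + int m * ?f + t + int m * u (y + 1 + int m * ?f)
          = y + t + int m * u y + 1 + int m * ?g] (mod 2 * int m)"
        using hom[of y "y + d"] unfolding g by (simp only: \<phi>_eq)
      then have "[y + t + 1 + int m * (?f + u (y + 1 + int m * ?f)) = y + t + 1 + int m * (u y + ?g)] (mod 2 * int m)"
        by (simp add: algebra_simps)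
      then have "even (?f + u (y + 1 + int m * ?f) - (u y + ?g))"
        using \<open>m > 0\<close> by (simp only: cong_add_lcancel cong_double_mult_iff)
      moreover have "even ?f \<longleftrightarrow> even (shape m H d + defect m H y)"
        "even ?g \<longleftrightarrow> even (shape m K d + defect m K (y + t))"
        by (simp_all add: shape_cocycle_def)
      ultimately show ?thesis
        using u_mult[of "y + 1" ?f] unfolding even_diff even_add by argo
    qed
    \<comment> \<open>Both shapes vanish at d = 0, which separates the defects from the
      shapes.\<close>
    have main0: "even (u (y + 1) - u y + defect m H y - defect m K (y + t))" for y
      using main[of y 0] by simp
    have "even (shape m H d - shape m K d)" for d
      using main[of 0 d] main0[of 0] by presburger
    from shape_eqD[OF this] have "H - {0} = K - {0}" .
    then have nonzero: "x \<in> H \<longleftrightarrow> x \<in> K" if "x \<noteq> 0" for x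
      using that by (metis DiffD1 DiffI singletonD)
    \<comment> \<open>If just one defect were present, \<open>main0\<close> would give
      \<open>u\<close> a single odd increment per period, at -t or at 0 according to whether it
      belongs to \<open>K\<close> or \<open>H\<close>.\<close>
    have zero: "0 \<in> H \<longleftrightarrow> 0 \<in> K"
    proof (rule ccontr)
      assume "\<not> (0 \<in> H \<longleftrightarrow> 0 \<in> K)"
      then consider "0 \<in> H" "0 \<notin> K" | "0 \<notin> H" "0 \<in> K" by blast
      then show False
      proof cases
        case 1
        then show False using main0 by (intro no_parity_defect[where u = u and c = t, OF \<open>m > 0\<close> u_period]) (simp add: defect_def)
      next
        case 2
        then show False using main0 by (intro no_parity_defect[where u = u and c = 0, OF \<open>m > 0\<close> u_period]) (simp add: defect_def)
      qed
    qed
    show ?thesis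
    proof (rule Set.set_eqI)
      show "x \<in> H \<longleftrightarrow> x \<in> K" for x using nonzero zero by (cases "x = 0") simp_all
    qed
  qed
qed

section \<open>Indecomposability, non-isomorphism and the count\<close>

abbreviation shape_solution :: "nat \<Rightarrow> nat set \<Rightarrow> nat ybe" where
  "shape_solution m H \<equiv> cyclic_cocycle.solution (2 * m) m (shape_cocycle m H)"

text \<open>An even value of the cocycle at y provides the unit step there: the cocycle is zero for
  H = {0}, and otherwise takes both parities.\<close>

lemma indecomposable_shape_solution:
  assumes "m > 0" "H \<subseteq> {..<m}" "H \<noteq> {}"
  shows "indecomposable (shape_solution m H)"
proof -
  interpret cyclic_cocycle "2 * m" m "shape_cocycle m H"
    by (rule cyclic_cocycle_shape[OF \<open>m > 0\<close>])
  have "\<exists>x. even (shape_cocycle m H x y)" for y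
  proof (cases "H = {0}")
    case True
    then show ?thesis by (simp add: shape_cocycle_def shape_def defect_def)
  next
    case False
    then show ?thesis using shape_cocycle_parity[OF assms(2,3), of y True] by simp
  qed
  then show ?thesis
    using cong_double_mult_iff[OF \<open>m > 0\<close>, of _ 0] by (intro indecomposable_solution) simp
qed

lemma isomorphic_shape_solution_imp_eq:
  assumes "m > 0" "H \<subseteq> {..<m}" "H \<noteq> {}" "K \<subseteq> {..<m}" "K \<noteq> {}"
    and "isomorphic (shape_solution m H) (shape_solution m K)"
  shows "H = K"
proof -
  interpret A: cyclic_cocycle "2 * m" m "shape_cocycle m H"
    by (rule cyclic_cocycle_shape[OF \<open>m > 0\<close>])
  interpret B: cyclic_cocycle "2 * m" m "shape_cocycle m K"
    by (rule cyclic_cocycle_shape[OF \<open>m > 0\<close>])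
  obtain \<Phi> where bij: "bij_betw \<Phi> (carrier A.solution) (carrier B.solution)"
    and hom: "\<And>x y. x \<in> carrier A.solution \<Longrightarrow> y \<in> carrier A.solution \<Longrightarrow>
      \<Phi> (sigma A.solution x y) = sigma B.solution (\<Phi> x) (\<Phi> y)"
    using assms(6) by (auto simp: isomorphic_def ybe_iso_def)
  define \<phi> where "\<phi> y = int (\<Phi> (A.elt y))" for y
  have "\<Phi> (A.elt y) < 2 * m" for y
    using bij_betw_apply[OF bij A.elt_in_carrier] by (simp add: B.solution_def)
  \<comment> \<open>\<open>elt\<close> depends on the modulus only, so \<open>A.elt\<close> also
    describes the target carrier.\<close>
  then have \<Phi>: "\<Phi> (A.elt y) = A.elt (\<phi> y)" for y
    by (simp add: \<phi>_def A.elt_int)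
  show ?thesis
  proof (rule shape_rigid[OF assms(1-5), of \<phi>])
    fix x y
    have "\<Phi> (A.elt (A.left_map x y)) = B.elt (B.left_map (\<phi> x) (\<phi> y))"
      using hom[of "A.elt x" "A.elt y"] by (simp add: \<Phi>)
    then show "[\<phi> (y + 1 + int m * shape_cocycle m H x y)
        = \<phi> y + 1 + int m * shape_cocycle m K (\<phi> x) (\<phi> y)] (mod 2 * int m)"
      by (simp add: \<Phi> A.elt_eq_iff A.left_map_def B.left_map_def)
    have "\<Phi> (A.elt x) = \<Phi> (A.elt y) \<longleftrightarrow> A.elt x = A.elt y"
      using bij by (auto simp: bij_betw_def inj_on_eq_iff)
    then show "[\<phi> x = \<phi> y] (mod 2 * int m) \<longleftrightarrow> [x = y] (mod 2 * int m)"
      by (simp add: \<Phi> A.elt_eq_iff)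
  next
    fix w
    have "A.elt w \<in> \<Phi> ` range A.elt"
      using bij_betw_imp_surj_on[OF bij] B.elt_in_carrier[of w] by (simp add: A.carrier_solution)
    then obtain x where "\<Phi> (A.elt x) = A.elt w" by fastforce
    then show "\<exists>x. [\<phi> x = w] (mod 2 * int m)"
      by (auto simp: \<Phi> A.elt_eq_iff)
  qed
qed

lemma isomorphic_refl: "isomorphic S S"
  by (auto simp: isomorphic_def ybe_iso_def intro!: exI[of _ "\<lambda>x. x"] bij_betw_id[unfolded id_def])

theorem corollary6p4:
  fixes s n :: nat
  assumes "s \<ge> 1" and "n = 2 ^ s"
  shows "\<exists>\<S> :: nat ybe set.
    finite \<S> \<and> card \<S> \<ge> 2 ^ (n div 2) - 1 \<and>
    (\<forall>S \<in> \<S>. ybe_solution S \<and> indecomposable S \<and> card (carrier S) = n) \<and>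
    (\<forall>S \<in> \<S>. \<forall>T \<in> \<S>. S \<noteq> T \<longrightarrow> \<not> isomorphic S T)"
proof -
  define m where "m = n div 2"
  have n: "n = 2 * m" "m > 0"
    using assms by (cases s; simp add: m_def)+
  let ?I = "Pow {..<m} - {{}}"
  \<comment> \<open>Equal solutions are isomorphic, so distinct subsets give distinct members of the
    family and the image has 2^m - 1 elements.\<close>
  have inj: "inj_on (shape_solution m) ?I"
  proof (rule inj_onI)
    fix H K
    assume "H \<in> ?I" "K \<in> ?I" "shape_solution m H = shape_solution m K"
    then show "H = K"
      using isomorphic_shape_solution_imp_eq[OF n(2), of H K] isomorphic_refl by auto
  qed
  have "card (shape_solution m ` ?I) = 2 ^ (n div 2) - 1"
    unfolding card_image[OF inj] by (simp add: card_Diff_subset card_Pow m_def)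
  moreover have "ybe_solution (shape_solution m H)" for H
    by (rule cyclic_cocycle.ybe_solution_solution[OF cyclic_cocycle_shape[OF n(2)]])
  moreover have "card (carrier (shape_solution m H)) = n" for H
    using n by (simp add: cyclic_cocycle.solution_def[OF cyclic_cocycle_shape])
  moreover have "indecomposable (shape_solution m H)" if "H \<in> ?I" for H
    using that by (intro indecomposable_shape_solution[OF n(2)]) auto
  moreover have "\<not> isomorphic (shape_solution m H) (shape_solution m K)"
    if "H \<in> ?I" "K \<in> ?I" "shape_solution m H \<noteq> shape_solution m K" for H K
    using that isomorphic_shape_solution_imp_eq[OF n(2), of H K] by auto
  moreover have "finite ?I" by simp
  ultimately show ?thesis
    by (intro exI[of _ "shape_solution m ` ?I"] conjI ballI impI finite_imageI)
      (simp_all only: image_iff, blast+)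
qed

end
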